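(* Let $N\ge 2$ be an integer, $h=0$, $a=1$, $b>0$, $m>0$ and $0\le\theta<2\pi/N$. If the configuration formed by two twisted regular $N$-gons with parameters $(N,a,b,m,h,\theta)=(N,1,b,m,0,\theta)$ is a central configuration, then $b=1$ and $\theta=\pi/N$. Moreover, for $b=1$ and $\theta=\pi/N$ the configuration is a central configuration; that is, there is exactly one central configuration formed by two regular $N$-gons on the same unit circle, namely the regular $2N$-gon (with equal masses).
   Context: Identify $\mathbb{R}^3$ with $\mathbb{C}\times\mathbb{R}$. For $1\le k\le N$ let $\theta_k=2k\pi/N$, $\rho_k=e^{i\theta_k}$ and $\tilde\rho_k=a\rho_k e^{i\theta}$. The configuration formed by two twisted regular $N$-gons with parameters $(N,a,b,m,h,\theta)$ consists of $2N$ point masses: a mass $m$ at each point $q_k=(\rho_k,0)$ and a mass $bm$ at each point $\tilde q_k=(\tilde\rho_k,h)$, $1\le k\le N$. Here $h$ is the distance between the two layers and $\theta$ is the twisted angle. By the rotational symmetry of the polygons, $\theta$ matters only modulo $2\pi/N$. Central configuration: point masses $\mu_1,\dots,\mu_n>0$ at positions $x_1,\dots,x_n\in\mathbb{R}^3$ form a central configuration if the positions are pairwise distinct and, with $z_0=\left(\sum_j \mu_j x_j\right)/\left(\sum_j\mu_j\right)$ the center of mass and $y_k=x_k-z_0$, there is $\lambda\in\mathbb{R}$ such that $\sum_{j\ne k}\frac{\mu_j\mu_k}{|y_j-y_k|^3}(y_j-y_k)=-\lambda\mu_k y_k$ for all $1\le k\le n$. *)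

theory Defs
  imports "HOL-Analysis.Analysis"
begin

text \<open>Three-dimensional space is the product of the complex plane and the real line; the product
  norm of the library, the square root of the sum of the squared norms, is the Euclidean one.\<close>

type_synonym space = "complex \<times> real"

definition center_of_mass :: "'i set \<Rightarrow> ('i \<Rightarrow> real) \<Rightarrow> ('i \<Rightarrow> space) \<Rightarrow> space" where
  "center_of_mass I \<mu> x = (\<Sum>j\<in>I. \<mu> j *\<^sub>R x j) /\<^sub>R (\<Sum>j\<in>I. \<mu> j)"

definition central_configuration :: "'i set \<Rightarrow> ('i \<Rightarrow> real) \<Rightarrow> ('i \<Rightarrow> space) \<Rightarrow> bool" where
  "central_configuration I \<mu> x \<longleftrightarrow>
     finite I \<and> (\<forall>k\<in>I. \<mu> k > 0) \<and> inj_on x I \<and>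
     (let y = (\<lambda>k. x k - center_of_mass I \<mu> x) in
        \<exists>lam::real. \<forall>k\<in>I.
          (\<Sum>j\<in>I - {k}. (\<mu> j * \<mu> k / norm (y j - y k) ^ 3) *\<^sub>R (y j - y k)) = - (lam * \<mu> k) *\<^sub>R y k)"

definition ngon_vertex :: "nat \<Rightarrow> nat \<Rightarrow> complex" where
  "ngon_vertex N k = cis (2 * real k * pi / real N)"

text \<open>The \<open>2N\<close> bodies are indexed by a disjoint sum: \<open>Inl k\<close> is the \<open>k\<close>-th body of the first
  polygon and \<open>Inr k\<close> the \<open>k\<close>-th body of the second, twisted one.\<close>

definition twisted_index :: "nat \<Rightarrow> (nat + nat) set" where
  "twisted_index N = {1..N} <+> {1..N}"

fun twisted_mass :: "real \<Rightarrow> real \<Rightarrow> nat + nat \<Rightarrow> real" where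
  "twisted_mass b m (Inl k) = m"
| "twisted_mass b m (Inr k) = b * m"

fun twisted_position :: "nat \<Rightarrow> real \<Rightarrow> real \<Rightarrow> real \<Rightarrow> nat + nat \<Rightarrow> space" where
  "twisted_position N a h \<theta> (Inl k) = (ngon_vertex N k, 0)"
| "twisted_position N a h \<theta> (Inr k) = (complex_of_real a * ngon_vertex N k * cis \<theta>, h)"

definition twisted_ngons_central ::
  "nat \<Rightarrow> real \<Rightarrow> real \<Rightarrow> real \<Rightarrow> real \<Rightarrow> real \<Rightarrow> bool" where
  "twisted_ngons_central N a b m h \<theta> \<longleftrightarrow>
     central_configuration (twisted_index N) (twisted_mass b m) (twisted_position N a h \<theta>)"

end

theory Submission
  imports Defs
begin

text \<open>By rotational symmetry the equations of all bodies reduce to one complex equation per polygon: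
  with \<open>P\<close> the pull of a regular \<open>N\<close>-gon on one of its own vertices and \<open>Q\<close> its pull on a point of
  the circle at angle \<open>\<theta>\<close>, they say that \<open>P + b Q\<close> and \<open>cnj Q + b P\<close> are equal and real. As \<open>P\<close> is real,
  this means \<open>Im Q = 0\<close> and \<open>(1 - b) (P - Re Q) = 0\<close>.

  Up to a factor, \<open>Im Q\<close> is the sum of \<open>cos t / sin\<^sup>2 t\<close> over \<open>t = \<theta>/2 + \<pi>j/N\<close>, which is strictly
  decreasing in \<open>\<theta>\<close> and vanishes at \<open>\<theta> = \<pi>/N\<close> by symmetry. For this \<open>\<theta>\<close>, midpoint convexity of
  \<open>1 / sin\<close> gives \<open>Re Q < P\<close>, so \<open>b = 1\<close>.\<close>

section \<open>The pull of a regular polygon on a point of its circle\<close>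

definition pull :: "complex \<Rightarrow> complex" where
  "pull w = (w - 1) /\<^sub>R norm (w - 1) ^ 3"

text \<open>As \<open>pull 1 = 0\<close> by division by zero, \<open>w = 1\<close> needs no separate
  case: the attracted vertex drops out of its own sum. Summing over the roots of unity turns the
  rotation and conjugation symmetries into reindexings.\<close>

definition ngon_pull :: "nat \<Rightarrow> complex \<Rightarrow> complex" where
  "ngon_pull N w = (\<Sum>z | z ^ N = 1. pull (z * w))"

lemma bij_betw_ngon_vertex:
  assumes "N > 0"
  shows "bij_betw (ngon_vertex N) {1..N} {z. z ^ N = 1}"
proof -
  have inj: "inj_on (ngon_vertex N) {1..N}"
  proof
    fix j k assume jk: "j \<in> {1..N}" "k \<in> {1..N}" "ngon_vertex N j = ngon_vertex N k"
    \<comment> \<open>The known bijection starts at index 0 and \<open>ngon_vertex\<close> at 1. The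
      shift is a common factor, which cancels.\<close>
    have "ngon_vertex N i = cis (2 * pi / N) * cis (2 * pi * real (i - 1) / real N)" if "i \<in> {1..N}" for i
      using that assms by (auto simp: ngon_vertex_def cis_mult of_nat_diff field_simps)
    then have "cis (2 * pi * real (j - 1) / real N) = cis (2 * pi * real (k - 1) / real N)"
      using jk by simp
    moreover have "j - 1 \<in> {..<N}" "k - 1 \<in> {..<N}"
      using jk by auto
    ultimately have "j - 1 = k - 1"
      by (rule inj_onD[OF bij_betw_imp_inj_on[OF Complex.bij_betw_roots_unity[OF assms]]])
    with jk show "j = k" by auto
  qed
  moreover have "ngon_vertex N ` {1..N} = {z. z ^ N = 1}"
  proof (rule card_subset_eq)
    show "finite {z::complex. z ^ N = 1}"
      using assms by (simp add: finite_roots_unity)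
    show "ngon_vertex N ` {1..N} \<subseteq> {z. z ^ N = 1}"
    proof (safe)
      fix k
      have "ngon_vertex N k ^ N = cis (2 * pi * real k)"
        unfolding ngon_vertex_def Complex.DeMoivre using assms by (simp add: mult_ac)
      then show "ngon_vertex N k ^ N = 1"
        by (simp add: cis_multiple_2pi)
    qed
    show "card (ngon_vertex N ` {1..N}) = card {z::complex. z ^ N = 1}"
      using inj assms by (simp add: card_image card_roots_unity_eq)
  qed
  ultimately show ?thesis
    by (simp add: bij_betw_def)
qed

lemma ngon_vertex_power: "N > 0 \<Longrightarrow> k \<in> {1..N} \<Longrightarrow> ngon_vertex N k ^ N = 1"
  using bij_betwE[OF bij_betw_ngon_vertex] by blast

lemma sum_ngon_vertex: "N > 0 \<Longrightarrow> (\<Sum>k=1..N. f (ngon_vertex N k)) = (\<Sum>z | z ^ N = 1. f z)"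
  by (rule sum.reindex_bij_betw[OF bij_betw_ngon_vertex])

lemma ngon_pull_sum:
  assumes "N > 0"
  shows "ngon_pull N w = (\<Sum>j<N. pull (cis (2 * pi * real j / real N) * w))"
  unfolding ngon_pull_def
  by (rule sum.reindex_bij_betw[OF Complex.bij_betw_roots_unity[OF assms], symmetric])

lemma ngon_pull_rotate:
  assumes "r ^ N = 1" "N > 0"
  shows "ngon_pull N (r * w) = ngon_pull N w"
proof -
  have "r \<noteq> 0" using assms by (auto simp: power_0_left)
  then have "bij_betw (\<lambda>z. z * r) {z. z ^ N = 1} {z. z ^ N = 1}"
    using assms by (intro bij_betwI[of _ _ _ "\<lambda>z. z / r"]) (auto simp: power_mult_distrib power_divide)
  from sum.reindex_bij_betw[OF this, of "\<lambda>z. pull (z * w)"] show ?thesis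
    by (simp add: ngon_pull_def mult.assoc)
qed

lemma pull_cnj: "pull (cnj w) = cnj (pull w)"
proof -
  have "cnj w - 1 = cnj (w - 1)" by simp
  then show ?thesis
    unfolding pull_def by (simp only: complex_mod_cnj complex_cnj_scaleR)
qed

lemma ngon_pull_cnj: "ngon_pull N (cnj w) = cnj (ngon_pull N w)"
proof -
  have "bij_betw cnj {z. z ^ N = 1} {z. z ^ N = 1}"
    by (intro bij_betwI[of _ _ _ cnj]) (auto simp flip: complex_cnj_power)
  from sum.reindex_bij_betw[OF this, of "\<lambda>z. pull (z * cnj w)"] show ?thesis
    by (simp add: ngon_pull_def flip: pull_cnj)
qed

text \<open>Multiplication by \<open>cnj u\<close>, the inverse of \<open>u\<close>, is a rotation
  that moves the attracted point \<open>u\<close> to 1 and keeps distances.\<close>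

lemma attraction_unit_circle:
  assumes "norm u = 1"
  shows "(v - u) /\<^sub>R norm (v - u) ^ 3 = u * pull (v * cnj u)"
proof -
  have u: "u * cnj u = 1"
    using assms complex_norm_square[of u] by simp
  then have eq: "v - u = u * (v * cnj u - 1)"
    by (simp add: algebra_simps)
  have n: "norm (v - u) = norm (v * cnj u - 1)"
    unfolding eq by (simp add: norm_mult assms)
  show ?thesis
    unfolding pull_def n by (subst eq) simp
qed

text \<open>Here \<open>c\<close> is the offset of the attracting polygon and \<open>r * w\<close> a
  body of a polygon with offset \<open>w\<close>. Since \<open>r\<close> drops out of the last
  factor, the bodies of one polygon feel the same force up to rotation.\<close>

lemma ngon_attraction:
  assumes "N > 0" "norm c = 1" "norm w = 1" "r ^ N = 1"
  shows "(\<Sum>j=1..N. (ngon_vertex N j * c - r * w) /\<^sub>R norm (ngon_vertex N j * c - r * w) ^ 3)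
           = r * w * ngon_pull N (c * cnj w)"
proof -
  have nr: "norm r = 1"
    using assms by (metis norm_ge_zero norm_one norm_power power_eq_1_iff not_gr_zero)
  then have "norm (r * w) = 1"
    using assms by (simp add: norm_mult)
  note att = attraction_unit_circle[OF this]
  have "(\<Sum>j=1..N. (ngon_vertex N j * c - r * w) /\<^sub>R norm (ngon_vertex N j * c - r * w) ^ 3)
      = r * w * (\<Sum>j=1..N. pull (ngon_vertex N j * (cnj r * (c * cnj w))))"
    unfolding att sum_distrib_left by (simp add: mult_ac)
  also have "\<dots> = r * w * ngon_pull N (cnj r * (c * cnj w))"
    by (subst sum_ngon_vertex[OF assms(1)]) (simp add: ngon_pull_def)
  also have "\<dots> = r * w * ngon_pull N (c * cnj w)"
    using assms by (subst ngon_pull_rotate) (simp_all flip: complex_cnj_power)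
  finally show ?thesis .
qed

section \<open>Reduction of the force equations to one per polygon\<close>

lemma sum_twisted_index:
  "(\<Sum>i\<in>twisted_index N. f i) = (\<Sum>j=1..N. f (Inl j)) + (\<Sum>j=1..N. f (Inr j))"
  unfolding twisted_index_def by (simp add: sum.Plus)

text \<open>For \<open>N \<ge> 2\<close> the roots of unity sum to 0, so each polygon balances on
  its own for any mass ratio. Positions relative to the center of mass are therefore the positions
  themselves.\<close>

lemma center_of_mass_twisted:
  assumes "N \<ge> 2"
  shows "center_of_mass (twisted_index N) (twisted_mass b m) (twisted_position N 1 0 \<theta>) = 0"
proof -
  have "(\<Sum>j=1..N. ngon_vertex N j) = 0"
    using assms sum_ngon_vertex[of N id] sum_roots_unity[of N] by simp
  then have "(\<Sum>j=1..N. c *\<^sub>R (ngon_vertex N j * w, 0::real)) = 0" for c w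
    by (simp add: prod_eq_iff fst_sum snd_sum flip: sum_distrib_right scaleR_right.sum)
  from this[of m 1] this[of "b * m" "cis \<theta>"] show ?thesis
    by (simp add: center_of_mass_def sum_twisted_index)
qed

text \<open>A body sees its own polygon unturned. The second polygon seen from the first is turned
  by \<open>\<theta>\<close>, the first seen from the second by \<open>- \<theta>\<close>, whence
  the conjugate.\<close>

lemma twisted_force:
  fixes b m \<theta> :: real
  assumes "N \<ge> 2" "k \<in> twisted_index N"
  defines "\<mu> \<equiv> twisted_mass b m" and "x \<equiv> twisted_position N 1 0 \<theta>"
  shows "(\<Sum>j\<in>twisted_index N - {k}. (\<mu> j * \<mu> k / norm (x j - x k) ^ 3) *\<^sub>R (x j - x k))
    = \<mu> k *\<^sub>R (fst (x k) * (of_real m *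
        (case k of Inl _ \<Rightarrow> ngon_pull N 1 + of_real b * ngon_pull N (cis \<theta>)
                 | Inr _ \<Rightarrow> cnj (ngon_pull N (cis \<theta>)) + of_real b * ngon_pull N 1)), 0)"
proof -
  have N: "N > 0" using assms by simp
  have fin: "finite (twisted_index N)" by (simp add: twisted_index_def)
  \<comment> \<open>the summand \<open>j = k\<close> may be included, since it is \<open>0\<close> by \<open>x / 0 = 0\<close>\<close>
  have split: "(\<Sum>j\<in>twisted_index N - {k}. (\<mu> j * \<mu> k / norm (x j - x k) ^ 3) *\<^sub>R (x j - x k))
    = \<mu> k *\<^sub>R (\<Sum>j\<in>twisted_index N. \<mu> j *\<^sub>R ((x j - x k) /\<^sub>R norm (x j - x k) ^ 3))"
    unfolding scaleR_right.sum
    by (intro sum.mono_neutral_cong_left) (auto simp: fin divide_inverse mult_ac)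
  have attraction: "(\<Sum>j=1..N. c *\<^sub>R (((ngon_vertex N j * v, 0::real) - (r * w, 0))
        /\<^sub>R norm ((ngon_vertex N j * v, 0::real) - (r * w, 0)) ^ 3))
      = (of_real c * (r * w * ngon_pull N (v * cnj w)), 0)"
    if "norm v = 1" "norm w = 1" "r ^ N = 1" for c and r v w :: complex
    unfolding ngon_attraction[OF N that, symmetric]
    by (simp add: prod_eq_iff fst_sum snd_sum sum_distrib_left scaleR_conv_of_real norm_Pair)
  \<comment> \<open>The factor 1 gives both polygons the form that \<open>attraction\<close>
    expects.\<close>
  have x: "x (Inl j) = (ngon_vertex N j * 1, 0)" "x (Inr j) = (ngon_vertex N j * cis \<theta>, 0)" for j
    by (simp_all add: x_def)
  have \<mu>: "\<mu> (Inl j) = m" "\<mu> (Inr j) = b * m" for j :: nat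
    by (simp_all add: \<mu>_def)
  obtain i where i: "k = Inl i \<or> k = Inr i" "ngon_vertex N i ^ N = 1"
    using assms(2) N by (auto simp: twisted_index_def ngon_vertex_power)
  then consider "k = Inl i" | "k = Inr i" by blast
  then show ?thesis
  proof cases
    case 1
    then have xk: "x k = (ngon_vertex N i * 1, 0)"
      by (simp add: x)
    show ?thesis
      unfolding split unfolding sum_twisted_index x xk \<mu>
        attraction[OF norm_one norm_one i(2)] attraction[OF norm_cis norm_one i(2)]
      by (simp add: 1 algebra_simps)
  next
    case 2
    then have xk: "x k = (ngon_vertex N i * cis \<theta>, 0)"
      by (simp add: x)
    have unit: "cis \<theta> * cnj (cis \<theta>) = 1"
      by (simp add: cis_cnj cis_mult)
    show ?thesis
      unfolding split unfolding sum_twisted_index x xk \<mu>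
        attraction[OF norm_one norm_cis i(2)] attraction[OF norm_cis norm_cis i(2)]
        unit mult_1_left ngon_pull_cnj
      by (simp add: 2 algebra_simps)
  qed
qed

lemma twisted_ngons_central_iff:
  fixes b m \<theta> :: real
  assumes "N \<ge> 2" "m > 0" "b > 0"
  defines "P \<equiv> ngon_pull N 1" and "Q \<equiv> ngon_pull N (cis \<theta>)"
  shows "twisted_ngons_central N 1 b m 0 \<theta> \<longleftrightarrow>
    inj_on (twisted_position N 1 0 \<theta>) (twisted_index N) \<and> Im Q = 0 \<and> (b = 1 \<or> Re P = Re Q)"
proof -
  define F where "F k = of_real m * (case k of Inl _ \<Rightarrow> P + of_real b * Q
                 | Inr _ \<Rightarrow> cnj Q + of_real b * P)" for k :: "nat + nat"
  have "cnj P = P"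
    unfolding P_def using ngon_pull_cnj[of N 1] by simp
  then have P: "Im P = 0"
    by (metis complex_cnj cnj.simps(2) equal_neg_zero)
  \<comment> \<open>Mass and position cancel, which leaves a condition that depends only on the
    polygon.\<close>
  have *: "\<mu> *\<^sub>R (u * f, 0) = - (lam * \<mu>) *\<^sub>R (u, 0::real) \<longleftrightarrow> f = - of_real lam"
    if "\<mu> > 0" "u \<noteq> 0" for \<mu> lam :: real and u f :: complex
  proof -
    have "\<mu> *\<^sub>R (u * f, 0) = - (lam * \<mu>) *\<^sub>R (u, 0::real)
        \<longleftrightarrow> (of_real \<mu> * u) * f = (of_real \<mu> * u) * (- of_real lam)"
      by (simp add: scaleR_conv_of_real mult_ac)
    then show ?thesis
      using that by (simp only: mult_cancel_left) auto
  qed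
  have fin: "finite (twisted_index N)"
    by (simp add: twisted_index_def)
  have mass: "twisted_mass b m k > 0" for k
    using assms by (cases k) auto
  have force: "(\<Sum>j\<in>twisted_index N - {k}. (twisted_mass b m j * twisted_mass b m k /
         norm (twisted_position N 1 0 \<theta> j - twisted_position N 1 0 \<theta> k) ^ 3) *\<^sub>R
         (twisted_position N 1 0 \<theta> j - twisted_position N 1 0 \<theta> k))
      = - (lam * twisted_mass b m k) *\<^sub>R twisted_position N 1 0 \<theta> k \<longleftrightarrow> F k = - of_real lam"
    if "k \<in> twisted_index N" for k lam
  proof -
    have "twisted_position N 1 0 \<theta> k = (fst (twisted_position N 1 0 \<theta> k), 0)"
      by (cases k) auto
    moreover have "fst (twisted_position N 1 0 \<theta> k) \<noteq> 0"
      by (cases k) (simp_all add: ngon_vertex_def)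
    ultimately show ?thesis
      unfolding twisted_force[OF assms(1) that] using *[OF mass] by (metis F_def P_def Q_def)
  qed
  have "twisted_ngons_central N 1 b m 0 \<theta> \<longleftrightarrow>
    inj_on (twisted_position N 1 0 \<theta>) (twisted_index N) \<and>
    (\<exists>lam::real. \<forall>k\<in>twisted_index N. F k = - of_real lam)"
    unfolding twisted_ngons_central_def central_configuration_def center_of_mass_twisted[OF assms(1)]
      Let_def diff_0_right
    using fin mass by (auto simp only: force cong: ball_cong)
  \<comment> \<open>The new multiplier is \<open>- lam / m\<close>; it absorbs the sign and the
    common mass. One body of each polygon suffices, because \<open>F\<close> ignores the index under
    \<open>Inl\<close> and \<open>Inr\<close>.\<close>
  also have "(\<exists>lam::real. \<forall>k\<in>twisted_index N. F k = - of_real lam)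
    \<longleftrightarrow> (\<exists>lam::real. P + of_real b * Q = of_real lam \<and> cnj Q + of_real b * P = of_real lam)"
    (is "?L \<longleftrightarrow> ?R")
  proof
    assume ?L
    then obtain lam where "\<And>k. k \<in> twisted_index N \<Longrightarrow> F k = - of_real lam" by blast
    moreover have "Inl 1 \<in> twisted_index N" "Inr 1 \<in> twisted_index N"
      using assms by (auto simp: twisted_index_def)
    ultimately
    have "of_real m * (P + of_real b * Q) = - of_real lam" "of_real m * (cnj Q + of_real b * P) = - of_real lam"
      by (fastforce simp: F_def)+
    then have "P + of_real b * Q = of_real (- lam / m)" "cnj Q + of_real b * P = of_real (- lam / m)"
      using assms by (auto simp: field_simps)
    then show ?R by blast
  next
    assume ?R
    then obtain lam where "P + of_real b * Q = of_real lam" "cnj Q + of_real b * P = of_real lam" by blast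
    then have "F k = - of_real (- (m * lam))" for k
      by (simp add: F_def split: sum.split)
    then show ?L by blast
  qed
  \<comment> \<open>With \<open>P\<close> real, the two imaginary parts are \<open>b * Im Q\<close>
    and \<open>- Im Q\<close>.\<close>
  also have "\<dots> \<longleftrightarrow> Im Q = 0 \<and> (b = 1 \<or> Re P = Re Q)"
  proof -
    have "Re P + b * Re Q = Re Q + b * Re P \<longleftrightarrow> b = 1 \<or> Re P = Re Q"
      by algebra
    then show ?thesis
      using P assms by (auto simp: complex_eq_iff)
  qed
  finally show ?thesis .
qed

section \<open>Half-angle formulas and monotonicity in the twist\<close>

lemma pull_cis:
  assumes "sin t \<ge> 0"
  shows "pull (cis (2 * t)) = Complex (- (1 / sin t) / 4) (cos t / sin t ^ 2 / 4)"
proof -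
  have eq: "cis (2 * t) - 1 = Complex (- 2 * sin t ^ 2) (2 * sin t * cos t)"
    by (simp add: complex_eq_iff cos_double_sin sin_double)
  have "(- 2 * sin t ^ 2)\<^sup>2 + (2 * sin t * cos t)\<^sup>2 = (2 * sin t)\<^sup>2 * (sin t ^ 2 + cos t ^ 2)"
    by algebra
  then have "norm (cis (2 * t) - 1) = sqrt ((2 * sin t)\<^sup>2)"
    unfolding eq complex_norm by (simp only: sin_cos_squared_add mult_1_right)
  \<comment> \<open>The chord has length \<open>2 * \<bar>sin t\<bar>\<close>; the sign assumption
    removes the absolute value.\<close>
  then have n: "norm (cis (2 * t) - 1) = 2 * sin t"
    using assms by (simp only: real_sqrt_abs)
  show ?thesis
    \<comment> \<open>The chord vector is divided by \<open>8 * sin t ^ 3\<close>. If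
      \<open>sin t = 0\<close>, both sides are 0 by the convention on division.\<close>
    unfolding pull_def n unfolding eq
    by (rule complex_eqI; cases "sin t = 0"; simp add: divide_simps power2_eq_square power3_eq_cube)
qed

text \<open>The bounds on \<open>s\<close> keep all half-angles \<open>s + pi * j / N\<close> in
  \<open>[0, pi)\<close>, where \<open>pull_cis\<close> applies. The case \<open>s = 0\<close>
  covers \<open>ngon_pull N 1\<close>: its summand \<open>j = 0\<close> is the self-interaction and
  vanishes as a division by 0.\<close>

lemma ngon_pull_cis:
  assumes "N > 0" "0 \<le> s" "s < pi / real N"
  shows "Re (ngon_pull N (cis (2 * s))) = - (\<Sum>j<N. 1 / sin (s + pi * real j / real N)) / 4"
    and "Im (ngon_pull N (cis (2 * s)))
           = (\<Sum>j<N. cos (s + pi * real j / real N) / sin (s + pi * real j / real N) ^ 2) / 4"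
proof -
  have *: "pull (cis (2 * pi * real j / real N) * cis (2 * s))
     = Complex (- (1 / sin (s + pi * real j / real N)) / 4)
         (cos (s + pi * real j / real N) / sin (s + pi * real j / real N) ^ 2 / 4)" if "j < N" for j
  proof -
    have "real j + 1 \<le> real N" using that by simp
    then have "pi / real N * (real j + 1) \<le> pi / real N * real N"
      by (intro mult_left_mono) auto
    then have "sin (s + pi * real j / real N) \<ge> 0"
      using assms by (intro sin_ge_zero) (auto simp: distrib_left)
    from pull_cis[OF this] show ?thesis
      by (simp add: cis_mult algebra_simps)
  qed
  show "Re (ngon_pull N (cis (2 * s))) = - (\<Sum>j<N. 1 / sin (s + pi * real j / real N)) / 4"
    unfolding ngon_pull_sum[OF assms(1)] by (simp add: * sum_negf sum_divide_distrib)
  show "Im (ngon_pull N (cis (2 * s)))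
           = (\<Sum>j<N. cos (s + pi * real j / real N) / sin (s + pi * real j / real N) ^ 2) / 4"
    unfolding ngon_pull_sum[OF assms(1)] by (simp add: * sum_divide_distrib)
qed

text \<open>The derivative is \<open>- (sin x ^ 2 + 2 * cos x ^ 2) / sin x ^ 3\<close>, which is
  negative between 0 and pi.\<close>

lemma cos_over_sin_squared_strict_antimono:
  fixes s t :: real
  assumes "0 < s" "s < t" "t < pi"
  shows "cos t / sin t ^ 2 < cos s / sin s ^ 2"
proof (rule DERIV_neg_imp_decreasing[OF assms(2)])
  fix x assume "s \<le> x" "x \<le> t"
  then have pos: "sin x > 0"
    using assms by (intro sin_gt_zero) auto
  have "((\<lambda>x. cos x / sin x ^ 2) has_real_derivative
     (- sin x * sin x ^ 2 - cos x * (2 * sin x * cos x)) / (sin x ^ 2 * sin x ^ 2)) (at x)"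
    using pos by (auto intro!: derivative_eq_intros)
  moreover have "- sin x * sin x ^ 2 - cos x * (2 * sin x * cos x) = - (sin x ^ 3 + 2 * cos x ^ 2 * sin x)"
    by algebra
  moreover have "sin x ^ 3 + 2 * cos x ^ 2 * sin x > 0"
    using pos by (simp add: add_pos_nonneg)
  ultimately show "\<exists>y. ((\<lambda>x. cos x / sin x ^ 2) has_real_derivative y) (at x) \<and> y < 0"
    using pos by (intro exI conjI) (auto simp: divide_less_0_iff)
qed

text \<open>Every summand decreases: for such \<open>s\<close> and \<open>t\<close> no half-angle
  meets the poles 0 and pi.\<close>

lemma Im_ngon_pull_strict_antimono:
  assumes "N > 0" "0 < s" "s < t" "t < pi / real N"
  shows "Im (ngon_pull N (cis (2 * t))) < Im (ngon_pull N (cis (2 * s)))"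
proof -
  have "(\<Sum>j<N. cos (t + pi * real j / real N) / sin (t + pi * real j / real N) ^ 2)
      < (\<Sum>j<N. cos (s + pi * real j / real N) / sin (s + pi * real j / real N) ^ 2)"
  proof (rule sum_strict_mono)
    fix j assume "j \<in> {..<N}"
    then have "real j + 1 \<le> real N" by auto
    then have "pi / real N * (real j + 1) \<le> pi / real N * real N"
      by (intro mult_left_mono) auto
    then have "t + pi * real j / real N < pi"
      using assms by (simp add: field_simps)
    moreover have "s + pi * real j / real N > 0"
      using assms by (intro add_pos_nonneg) auto
    ultimately show "cos (t + pi * real j / real N) / sin (t + pi * real j / real N) ^ 2
      < cos (s + pi * real j / real N) / sin (s + pi * real j / real N) ^ 2"
      using assms by (intro cos_over_sin_squared_strict_antimono) auto
  qed (use assms in auto)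
  then show ?thesis
    using assms by (simp add: ngon_pull_cis)
qed

section \<open>The twist by half a step\<close>

lemma Im_ngon_pull_half:
  assumes "N > 0"
  shows "Im (ngon_pull N (cis (pi / real N))) = 0"
proof -
  have r: "cis (2 * pi / real N) ^ N = 1"
    using assms by (simp add: Complex.DeMoivre)
  \<comment> \<open>Reflection changes the twist pi/N to -pi/N, and a rotation by one vertex changes
    it back. So the pull is its own conjugate.\<close>
  have "cis (2 * pi / real N) * cnj (cis (pi / real N)) = cis (pi / real N)"
    by (simp add: cis_cnj cis_mult field_simps)
  then have "cnj (ngon_pull N (cis (pi / real N))) = ngon_pull N (cis (pi / real N))"
    using ngon_pull_rotate[OF r assms, of "cnj (cis (pi / real N))"] ngon_pull_cnj by simp
  then show ?thesis
    by (metis cnj.simps(2) equal_neg_zero)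
qed

text \<open>As \<open>cos d \<le> 1\<close>, the two outer sines sum to at most
  \<open>2 * sin x\<close>. The inequality of arithmetic and harmonic means then applies.\<close>

lemma inverse_sin_midpoint:
  fixes x d :: real
  assumes "sin (x - d) > 0" "sin (x + d) > 0" "sin x > 0"
  shows "2 / sin x \<le> 1 / sin (x - d) + 1 / sin (x + d)"
proof -
  define u v where "u = sin (x - d)" and "v = sin (x + d)"
  have uv: "u > 0" "v > 0" using assms by (auto simp: u_def v_def)
  have "u + v = 2 * sin x * cos d"
    by (simp add: u_def v_def sin_add sin_diff)
  also have "\<dots> \<le> 2 * sin x"
    using assms(3) by simp
  finally have "2 / sin x \<le> 4 / (u + v)"
    using uv assms(3) by (simp add: field_simps)
  also have "\<dots> \<le> 1 / u + 1 / v"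
  proof -
    have "4 * (u * v) \<le> (u + v) * (u + v)"
      using zero_le_power2[of "u - v"] by (simp add: power2_eq_square algebra_simps)
    then show ?thesis using uv by (simp add: field_simps)
  qed
  finally show ?thesis by (simp add: u_def v_def)
qed

text \<open>The half-angles \<open>pi * j / N\<close> with \<open>0 < j < N\<close>, which belong to
  \<open>ngon_pull N 1\<close>, are the midpoints of consecutive half-angles of the twisted polygon.
  Midpoint convexity is summed over these gaps; the minus sign in \<open>ngon_pull_cis\<close>
  reverses the inequality.\<close>

lemma Re_ngon_pull_half_less:
  assumes "N > 0"
  shows "Re (ngon_pull N (cis (pi / real N))) < Re (ngon_pull N 1)"
proof -
  define d where "d = pi / (2 * real N)"
  define g where "g j = 1 / sin (d + pi * real j / real N)" for j
  have d: "0 < d" "d < pi / real N" "2 * d = pi / real N"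
    using assms by (auto simp: d_def field_simps)
  have sin_pos: "sin (pi * y / real N) > 0" if "0 < y" "y < real N" for y
    using that assms by (intro sin_gt_zero) (auto simp: field_simps)
  have arg: "d + pi * real j / real N = pi * (real j + 1/2) / real N" for j
    using assms by (simp add: d_def field_simps)
  have g: "g j > 0" if "j < N" for j
    unfolding g_def arg using that by (auto intro!: sin_pos)
  obtain n where n: "N = Suc n" using assms by (cases N) auto
  have "2 / sin (pi * real (Suc j) / real N) \<le> g j + g (Suc j)" if "j < n" for j
  proof -
    have e: "pi * real (Suc j) / real N - d = pi * (real j + 1/2) / real N"
            "pi * real (Suc j) / real N + d = pi * (real (Suc j) + 1/2) / real N"
      using assms by (auto simp: d_def field_simps)
    show ?thesis
      unfolding g_def arg e[symmetric]
      by (rule inverse_sin_midpoint; (unfold e)?; rule sin_pos) (use that n in auto)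
  qed
  then have "(\<Sum>j<n. 2 / sin (pi * real (Suc j) / real N)) \<le> (\<Sum>j<n. g j + g (Suc j))"
    by (intro sum_mono) auto
  also have "\<dots> = (\<Sum>j<n. g j) + (\<Sum>j<n. g (Suc j))"
    by (simp add: sum.distrib)
  \<comment> \<open>The end terms \<open>g 0\<close> and \<open>g n\<close> are each missing once on
    the left, which makes the inequality strict.\<close>
  also have "\<dots> < 2 * (\<Sum>j<N. g j)"
    using g[of 0] g[of n] sum.lessThan_Suc_shift[of g n] sum.lessThan_Suc[of g n] by (simp add: n)
  also have "(\<Sum>j<n. 2 / sin (pi * real (Suc j) / real N)) = 2 * (\<Sum>j<n. 1 / sin (pi * real (Suc j) / real N))"
    by (simp add: sum_distrib_left)
  finally have "(\<Sum>j<n. 1 / sin (pi * real (Suc j) / real N)) < (\<Sum>j<N. g j)"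
    by simp
  \<comment> \<open>The summand \<open>j = 0\<close> is \<open>1 / sin 0 = 0\<close>.\<close>
  moreover have "(\<Sum>j<N. 1 / sin (0 + pi * real j / real N)) = (\<Sum>j<n. 1 / sin (pi * real (Suc j) / real N))"
    unfolding n sum.lessThan_Suc_shift by simp
  ultimately show ?thesis
    using ngon_pull_cis(1)[of N 0] ngon_pull_cis(1)[of N d] assms d by (simp add: g_def)
qed

section \<open>The regular 2N-gon\<close>

lemma inj_on_twisted_position_half:
  assumes "N > 0"
  shows "inj_on (twisted_position N 1 0 (pi / real N)) (twisted_index N)"
proof -
  have inj: "inj_on (ngon_vertex N) {1..N}"
    using bij_betw_ngon_vertex[OF assms] by (simp add: bij_betw_def)
  \<comment> \<open>The \<open>N\<close>-th power is 1 on the first polygon and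
    \<open>cis pi = -1\<close> on the second.\<close>
  have "ngon_vertex N j \<noteq> ngon_vertex N k * cis (pi / real N)" if "j \<in> {1..N}" "k \<in> {1..N}" for j k
  proof
    assume "ngon_vertex N j = ngon_vertex N k * cis (pi / real N)"
    then have "ngon_vertex N j ^ N = ngon_vertex N k ^ N * cis (pi / real N) ^ N"
      by (simp add: power_mult_distrib)
    with that assms show False
      by (simp add: ngon_vertex_power Complex.DeMoivre)
  qed
  note neq = this this[symmetric]
  show ?thesis
    by (rule inj_onI) (use neq in \<open>auto simp: twisted_index_def inj_on_eq_iff[OF inj]\<close>)
qed

text \<open>The first polygon gives the even vertices and the second the odd ones; inclusion and
  equal cardinality give equality.\<close>

lemma twisted_position_half_image:
  assumes "N > 0"
  shows "twisted_position N 1 0 (pi / real N) ` twisted_index N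
           = (\<lambda>k. (ngon_vertex (2 * N) k, 0)) ` {1..2 * N}"
    (is "?x ` _ = ?v ` _")
proof (rule card_subset_eq)
  have l: "?x (Inl k) = ?v (2 * k)" for k
    by (simp add: ngon_vertex_def mult_ac)
  have r: "?x (Inr k) = ?v (2 * k + 1)" for k
  proof -
    have "2 * real k * pi / real N + pi / real N = 2 * real (2 * k + 1) * pi / real (2 * N)"
      using assms by (simp add: divide_simps distrib_right)
    then show ?thesis
      by (simp only: ngon_vertex_def twisted_position.simps cis_mult of_real_1 mult_1_left)
  qed
  \<comment> \<open>For \<open>k = N\<close> the index \<open>2 * k + 1\<close> leaves the range
    \<open>{1..2 * N}\<close> and wraps around to 1.\<close>
  have "2 * real (2 * N + 1) * pi / real (2 * N) = 2 * pi + 2 * real 1 * pi / real (2 * N)"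
    using assms by (simp add: divide_simps distrib_right)
  then have "ngon_vertex (2 * N) (2 * N + 1) = ngon_vertex (2 * N) 1"
    by (simp only: ngon_vertex_def cis_mult[symmetric] cis_2pi mult_1_left)
  then have r': "?x (Inr k) = ?v (if k = N then 1 else 2 * k + 1)" for k
    unfolding r by simp
  show "?x ` twisted_index N \<subseteq> ?v ` {1..2 * N}"
  proof (rule image_subsetI)
    fix i assume "i \<in> twisted_index N"
    then consider k where "i = Inl k" "k \<in> {1..N}" | k where "i = Inr k" "k \<in> {1..N}"
      by (auto simp: twisted_index_def)
    then show "?x i \<in> ?v ` {1..2 * N}"
    proof cases
      case 1
      show ?thesis unfolding \<open>i = Inl k\<close> l by (rule imageI) (use 1 in auto)
    next
      case 2
      show ?thesis unfolding \<open>i = Inr k\<close> r' by (rule imageI) (use 2 in auto)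
    qed
  qed
  have "inj_on (ngon_vertex (2 * N)) {1..2 * N}"
    using bij_betw_ngon_vertex[of "2 * N"] assms by (simp add: bij_betw_imp_inj_on)
  then have "inj_on ?v {1..2 * N}"
    by (auto intro!: inj_onI dest: inj_onD)
  then have "card (?v ` {1..2 * N}) = 2 * N"
    by (simp add: card_image)
  moreover have "card (?x ` twisted_index N) = 2 * N"
    unfolding card_image[OF inj_on_twisted_position_half[OF assms]]
    by (simp add: twisted_index_def card_Plus)
  ultimately show "card (?x ` twisted_index N) = card (?v ` {1..2 * N})"
    by (simp only:)
  show "finite (?v ` {1..2 * N})"
    by (intro finite_imageI finite_atLeastAtMost)
qed

section \<open>Uniqueness and existence\<close>

theorem corollary1p9:
  fixes N :: nat and m :: real
  assumes "N \<ge> 2" and "m > 0"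
  shows "(\<forall>b \<theta>. b > 0 \<longrightarrow> 0 \<le> \<theta> \<longrightarrow> \<theta> < 2 * pi / real N \<longrightarrow>
            twisted_ngons_central N 1 b m 0 \<theta> \<longrightarrow> b = 1 \<and> \<theta> = pi / real N) \<and>
         twisted_ngons_central N 1 1 m 0 (pi / real N) \<and>
         (\<exists>!p. case p of (b, \<theta>) \<Rightarrow>
            b > 0 \<and> 0 \<le> \<theta> \<and> \<theta> < 2 * pi / real N \<and> twisted_ngons_central N 1 b m 0 \<theta>) \<and>
         twisted_position N 1 0 (pi / real N) ` twisted_index N
           = (\<lambda>k. (ngon_vertex (2 * N) k, 0)) ` {1..2 * N} \<and>
         (\<forall>i\<in>twisted_index N. twisted_mass 1 m i = m)"
proof -
  have N: "N > 0" using assms by simp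
  have uniq: "b = 1 \<and> \<theta> = pi / real N"
    if b: "b > 0" and \<theta>: "0 \<le> \<theta>" "\<theta> < 2 * pi / real N" and cc: "twisted_ngons_central N 1 b m 0 \<theta>" for b \<theta>
  proof -
    note cc' = cc[unfolded twisted_ngons_central_iff[OF assms b]]
    \<comment> \<open>Since \<open>ngon_pull N 1\<close> is real, the condition on the imaginary
      part also holds at 0. Only the distinctness of the positions excludes this twist.\<close>
    have "\<theta> \<noteq> 0"
    proof
      assume "\<theta> = 0"
      with cc' have "Inl 1 = (Inr 1 :: nat + nat)"
        using N by (auto dest: inj_onD[where x = "Inl 1" and y = "Inr 1"] simp: twisted_index_def)
      then show False by simp
    qed
    \<comment> \<open>Monotonicity is stated for half-angles, hence the instances at
      \<open>\<theta> / 2\<close>. On either side of pi/N the imaginary part is nonzero.\<close>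
    have "\<theta> = pi / real N"
    proof (rule linorder_cases[of \<theta> "pi / real N"])
      assume "\<theta> < pi / real N"
      then have "Im (ngon_pull N (cis (pi / real N))) < Im (ngon_pull N (cis \<theta>))"
        using Im_ngon_pull_strict_antimono[of N "\<theta> / 2" "pi / real N / 2"] N \<theta> \<open>\<theta> \<noteq> 0\<close>
        by (simp add: field_simps)
      then show ?thesis
        using cc' Im_ngon_pull_half[OF N] by simp
    next
      assume "pi / real N < \<theta>"
      then have "Im (ngon_pull N (cis \<theta>)) < Im (ngon_pull N (cis (pi / real N)))"
        using Im_ngon_pull_strict_antimono[of N "pi / real N / 2" "\<theta> / 2"] N \<theta>
        by (simp add: field_simps)
      then show ?thesis
        using cc' Im_ngon_pull_half[OF N] by simp
    qed
    with cc' Re_ngon_pull_half_less[OF N] show ?thesis by auto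
  qed
  have ex: "twisted_ngons_central N 1 1 m 0 (pi / real N)"
    using twisted_ngons_central_iff[OF assms, of 1] inj_on_twisted_position_half[OF N]
      Im_ngon_pull_half[OF N] by simp
  have "\<exists>!p. case p of (b, \<theta>) \<Rightarrow>
      b > 0 \<and> 0 \<le> \<theta> \<and> \<theta> < 2 * pi / real N \<and> twisted_ngons_central N 1 b m 0 \<theta>"
  proof (rule ex1I[of _ "(1, pi / real N)"])
    show "case (1, pi / real N) of (b, \<theta>) \<Rightarrow>
      b > 0 \<and> 0 \<le> \<theta> \<and> \<theta> < 2 * pi / real N \<and> twisted_ngons_central N 1 b m 0 \<theta>"
      using ex N by (simp add: divide_strict_right_mono)
  qed (use uniq in auto)
  moreover have "\<forall>i\<in>twisted_index N. twisted_mass 1 m i = m"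
    by (auto simp: twisted_index_def)
  ultimately show ?thesis
    using uniq ex twisted_position_half_image[OF N] by blast
qed

end
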